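(* Let $D$ be a normed division ring with norm $\lVert\cdot\rVert$. Let $R\subseteq D\setminus\{0\}$ be a subset such that $$M:=\inf\{\lVert x\rVert : x\in R\}>0.$$ Let $n\ge 1$, let $\mathcal{C}=(c_{i,j})$ be a non-commutative frieze over $R$ on an $(n+3)$-gon (with vertices $0,1,\dots,n+2$, indices read modulo $n+3$), and set $$P=\max\{\lVert c_{i,i+1}\rVert,\ \lVert c_{i+1,i}\rVert : 0\le i\le n+2\},$$ the maximal value of the norm of a boundary entry. Then for every vertex $j$ the quiddity entries $c_{j,j+2}$ and $c_{j+2,j}$ of $\mathcal{C}$ have norm at most $$\frac{P^2(M+nP)}{M^2}.$$
   Context: A normed division ring is an associative ring $D$ with unity in which every non-zero element is invertible, together with a function $\lVert\cdot\rVert:D\to\mathbb{R}_{\ge0}$ such that $\lVert a\rVert=0\Leftrightarrow a=0$, $\lVert ab\rVert=\lVert a\rVert\lVert b\rVert$ and $\lVert a+b\rVert\le\lVert a\rVert+\lVert b\rVert$ for all $a,b\in D$. Non-commutative friezes. Let $D$ be a ring with unit group $D^{*}$ and let $\mathcal{P}$ be an $m$-gon ($m\ge3$) with vertices $0,1,\dots,m-1$ in cyclic order (indices modulo $m$). Let $\mathrm{diag}(\mathcal{P})$ be the set of ordered pairs of distinct vertices (edges included, both orientations). A non-commutative frieze over $D$ on $\mathcal{P}$ is a map $c:\mathrm{diag}(\mathcal{P})\to D^{*}$, $(r,s)\mapsto c_{r,s}$, also written $\mathcal{C}=(c_{r,s})$, satisfying: (a) for all $r$: $c_{r+1,r+2}c_{r,r+2}^{-1}c_{r,r+1}=c_{r+1,r}c_{r+2,r}^{-1}c_{r+2,r+1}$;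 (b) for all $r,s$ with $r,r+1,s,s+1$ pairwise distinct: $c_{s,r}=c_{s,s+1}c_{r+1,s+1}^{-1}c_{r+1,r}+c_{s,r+1}c_{s+1,r+1}^{-1}c_{s+1,r}$, $c_{r,s}=c_{r,r+1}c_{s+1,r+1}^{-1}c_{s+1,s}+c_{r,s+1}c_{r+1,s+1}^{-1}c_{r+1,s}$, $c_{r+1,s+1}=c_{r+1,r}c_{s,r}^{-1}c_{s,s+1}+c_{r+1,s}c_{r,s}^{-1}c_{r,s+1}$, $c_{s+1,r+1}=c_{s+1,s}c_{r,s}^{-1}c_{r,r+1}+c_{s+1,r}c_{s,r}^{-1}c_{s,r+1}$. The boundary entries are the $c_{r,r+1}$ and $c_{r+1,r}$; the quiddity entries are the $c_{r,r+2}$ and $c_{r+2,r}$. For a subset $R\subseteq D\setminus\{0\}$ of a division ring $D$, a non-commutative frieze over $R$ is a non-commutative frieze over $D$ all of whose entries $c_{r,s}$ ($r\ne s$) lie in $R$ (inverses are taken in $D$). *)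

theory Defs
  imports Complex_Main
begin

locale normed_division_ring =
  fixes nrm :: "'a::division_ring \<Rightarrow> real"
  assumes nrm_nonneg: "nrm a \<ge> 0"
    and nrm_eq_0_iff: "nrm a = 0 \<longleftrightarrow> a = 0"
    and nrm_mult: "nrm (a * b) = nrm a * nrm b"
    and nrm_triangle: "nrm (a + b) \<le> nrm a + nrm b"

text \<open>Vertices of the \<open>m\<close>-gon are the natural numbers below \<open>m\<close>. The function
  \<open>entry m c\<close> reads indices modulo \<open>m\<close>, so only the values \<open>c r s\<close> with
  \<open>r, s < m\<close> are used.\<close>

definition entry :: "nat \<Rightarrow> (nat \<Rightarrow> nat \<Rightarrow> 'a) \<Rightarrow> nat \<Rightarrow> nat \<Rightarrow> 'a" where
  "entry m c r s = c (r mod m) (s mod m)"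

text \<open>Over a division ring the unit group consists of the nonzero elements. Diagonal values
  \<open>c r r\<close> are unconstrained and do not occur in the relations.\<close>

locale nc_frieze =
  fixes m :: nat and c :: "nat \<Rightarrow> nat \<Rightarrow> 'a::division_ring"
  fixes e
  defines "e \<equiv> entry m c"
  assumes m_ge_3: "m \<ge> 3"
    and unit_entries: "\<lbrakk>r < m; s < m; r \<noteq> s\<rbrakk> \<Longrightarrow> c r s \<noteq> 0"
    and triangle_relation: "r < m \<Longrightarrow>
      e (r+1) (r+2) * inverse (e r (r+2)) * e r (r+1)
        = e (r+1) r * inverse (e (r+2) r) * e (r+2) (r+1)"
    and exchange_relations:
      "\<lbrakk>r < m; s < m; distinct [r, (r+1) mod m, s, (s+1) mod m]\<rbrakk> \<Longrightarrow>
        e s r = e s (s+1) * inverse (e (r+1) (s+1)) * e (r+1) r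
                + e s (r+1) * inverse (e (s+1) (r+1)) * e (s+1) r \<and>
        e r s = e r (r+1) * inverse (e (s+1) (r+1)) * e (s+1) s
                + e r (s+1) * inverse (e (r+1) (s+1)) * e (r+1) s \<and>
        e (r+1) (s+1) = e (r+1) r * inverse (e s r) * e s (s+1)
                + e (r+1) s * inverse (e r s) * e r (s+1) \<and>
        e (s+1) (r+1) = e (s+1) s * inverse (e r s) * e r (r+1)
                + e (s+1) r * inverse (e s r) * e s (r+1)"

definition nc_frieze_over :: "'a::division_ring set \<Rightarrow> nat \<Rightarrow> (nat \<Rightarrow> nat \<Rightarrow> 'a) \<Rightarrow> bool" where
  "nc_frieze_over R m c \<longleftrightarrow>
     nc_frieze m c \<and> (\<forall>r<m. \<forall>s<m. r \<noteq> s \<longrightarrow> c r s \<in> R)"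

end

theory Submission
  imports Defs
begin

text \<open>Fix the edge \<open>(j, j+1)\<close> and let \<open>k\<close> run around the polygon over the other vertices. Dividing the exchange
  relation for \<open>c\<^bsub>j,k\<^esub>\<close> on the right by \<open>c\<^bsub>j+1,k\<^esub>\<close> shows that the quotients
  \<open>x\<^sub>k = c\<^bsub>j,k\<^esub> c\<^bsub>j+1,k\<^esub>\<^sup>-\<^sup>1\<close> satisfy
  \<open>x\<^sub>k = c\<^bsub>j,j+1\<^esub> c\<^bsub>k+1,j+1\<^esub>\<^sup>-\<^sup>1 c\<^bsub>k+1,k\<^esub> c\<^bsub>j+1,k\<^esub>\<^sup>-\<^sup>1 + x\<^bsub>k+1\<^esub>\<close>.
  The first summand contains two boundary entries and two inverses, so its norm is at most
  \<open>P\<^sup>2/M\<^sup>2\<close>. The recursion starts at the quiddity entry,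
  \<open>c\<^bsub>j,j+2\<^esub> = x\<^bsub>j+2\<^esub> c\<^bsub>j+1,j+2\<^esub>\<close>, and ends after \<open>n\<close> steps at the vertex preceding \<open>j\<close>, where
  the numerator of \<open>x\<^sub>k\<close> is a boundary entry and hence the norm of \<open>x\<^sub>k\<close> is at most \<open>P/M\<close>.
  Together, \<open>\<parallel>c\<^bsub>j,j+2\<^esub>\<parallel> \<le> P (P/M + n P\<^sup>2/M\<^sup>2)\<close>, which is the claimed bound.

  For \<open>c\<^bsub>j+2,j\<^esub>\<close> one divides on the left instead. After taking norms the order of the factors
  is immaterial, so both cases follow from a single statement on real numbers,
  \<open>quiddity_bound_of_exchange_inequality\<close>, applied to the array of norms and to its transpose.\<close>

context normed_division_ring
begin

lemma nrm_inverse: "nrm (inverse a) = inverse (nrm a)"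
proof (cases "a = 0")
  case True
  then show ?thesis by (simp add: nrm_eq_0_iff[THEN iffD2])
next
  case False
  have "nrm 1 * nrm 1 = nrm 1" "nrm 1 \<noteq> 0"
    using nrm_mult[of 1 1] by (simp_all add: nrm_eq_0_iff)
  then have "nrm 1 = 1" by simp
  then have "nrm (inverse a) * nrm a = 1"
    using False by (simp flip: nrm_mult)
  then show ?thesis by (intro inverse_unique[symmetric]) (simp add: mult.commute)
qed

lemma nrm_exchange_le:
  "nrm (a * inverse b * d + a' * inverse b' * d')
     \<le> nrm a * nrm d / nrm b + nrm a' * nrm d' / nrm b'"
  using nrm_triangle[of "a * inverse b * d" "a' * inverse b' * d'"]
  by (simp add: nrm_mult nrm_inverse divide_inverse mult_ac)

end

text \<open>Telescoping of the quotients \<open>f j k / f (j+1) k\<close> for an array \<open>f\<close> of nonnegative reals that satisfies one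
  exchange relation as an inequality. The hypothesis on \<open>f j (j + n + 2)\<close> holds in a polygon with
  \<open>n + 3\<close> vertices because \<open>j + n + 2\<close> is there the predecessor of \<open>j\<close>.\<close>

lemma quiddity_bound_of_exchange_inequality:
  fixes f :: "nat \<Rightarrow> nat \<Rightarrow> real"
  assumes M: "0 < M"
    and nonneg: "\<And>r s. 0 \<le> f r s"
    and exchange: "\<And>k. \<lbrakk>j + 2 \<le> k; k \<le> j + n + 1\<rbrakk> \<Longrightarrow>
      f j k \<le> f j (j+1) * f (k+1) k / f (k+1) (j+1) + f j (k+1) * f (j+1) k / f (j+1) (k+1)"
    and lower: "\<And>k. \<lbrakk>j + 2 \<le> k; k \<le> j + n + 2\<rbrakk> \<Longrightarrow> M \<le> f (j+1) k \<and> M \<le> f k (j+1)"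
    and boundary: "\<And>k. f k (k+1) \<le> P \<and> f (k+1) k \<le> P"
    and last: "f j (j + n + 2) \<le> P"
  shows "f j (j+2) \<le> P\<^sup>2 * (M + real n * P) / M\<^sup>2"
proof -
  define x where "x k = f j k / f (j+1) k" for k
  have P: "0 \<le> P" using nonneg boundary order_trans by blast
  have step: "x k \<le> P\<^sup>2 / M\<^sup>2 + x (k+1)" if k: "j + 2 \<le> k" "k \<le> j + n + 1" for k
  proof -
    have pos: "0 < f (j+1) k" "M \<le> f (j+1) k" "M \<le> f (k+1) (j+1)"
      using lower[of k] lower[of "k+1"] k M by auto
    have "x k \<le> (f j (j+1) * f (k+1) k / f (k+1) (j+1)
                  + f j (k+1) * f (j+1) k / f (j+1) (k+1)) / f (j+1) k"
      unfolding x_def using exchange[OF k] pos by (intro divide_right_mono) auto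
    also have "\<dots> = f j (j+1) * f (k+1) k / (f (k+1) (j+1) * f (j+1) k) + x (k+1)"
      using pos by (simp add: x_def add_divide_distrib)
    also have "f j (j+1) * f (k+1) k / (f (k+1) (j+1) * f (j+1) k) \<le> (P * P) / (M * M)"
      using boundary[of j] boundary[of k] pos M nonneg P
      by (intro frac_le mult_mono mult_pos_pos mult_nonneg_nonneg) auto
    finally show ?thesis by (simp add: power2_eq_square)
  qed
  \<comment> \<open>The recursion is unwound from its far end, where the quotient is at most \<open>P / M\<close>; each of the
    \<open>d\<close> steps back towards \<open>j + 2\<close> costs \<open>P\<^sup>2 / M\<^sup>2\<close>.\<close>
  have tele: "x (j + n + 2 - d) \<le> P / M + real d * (P\<^sup>2 / M\<^sup>2)" if "d \<le> n" for d
    using that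
  proof (induction d)
    case 0
    show ?case
      using last lower[of "j + n + 2"] M P by (auto simp: x_def intro!: frac_le)
  next
    case (Suc d)
    define k where "k = j + n + 2 - Suc d"
    have k: "j + n + 2 - d = k + 1" "j + 2 \<le> k" "k \<le> j + n + 1"
      using Suc.prems by (auto simp: k_def)
    have "x (k+1) \<le> P / M + real d * (P\<^sup>2 / M\<^sup>2)" using Suc k(1) by simp
    with step[OF k(2,3)] have "x k \<le> P / M + real (Suc d) * (P\<^sup>2 / M\<^sup>2)"
      by (simp add: distrib_right add_divide_distrib)
    then show ?case by (simp only: k_def)
  qed
  have pos: "0 < f (j+1) (j+2)" using lower[of "j+2"] M by simp
  have "f j (j+2) = x (j+2) * f (j+1) (j+2)" using pos by (simp add: x_def)
  also have "\<dots> \<le> (P / M + real n * (P\<^sup>2 / M\<^sup>2)) * P"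
    using tele[of n] boundary[of "j+1"] pos P M
    by (intro mult_mono) (auto simp: add.commute)
  also have "\<dots> = P\<^sup>2 * (M + real n * P) / M\<^sup>2"
    using M by (simp add: field_simps power2_eq_square)
  finally show ?thesis .
qed

lemma entry_mod:
  "entry m c (r mod m) s = entry m c r s" "entry m c r (s mod m) = entry m c r s"
  "entry m c (r mod m + 1) s = entry m c (r + 1) s"
  "entry m c r (s mod m + 1) = entry m c r (s + 1)"
  by (simp_all add: entry_def mod_Suc_eq)

lemma mod_neq_of_less_window:
  fixes a b m :: nat
  assumes "a < b" "b < a + m"
  shows "a mod m \<noteq> b mod m"
proof
  assume "a mod m = b mod m"
  then have "m dvd b - a" using assms by (metis less_imp_le mod_eq_dvd_iff_nat)
  then show False using assms by (auto dest: dvd_imp_le)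
qed

text \<open>Indices are reduced modulo \<open>m\<close> by \<open>entry\<close>, so a vertex may be given by any representative.
  With \<open>s\<close> fixed and \<open>r\<close> counting upwards from it, the walk around the polygon passes the vertex
  \<open>0\<close> without a case distinction.\<close>

lemma exchange_relations_cyclic:
  assumes "nc_frieze m c" and "s + 2 \<le> r" and "r + 1 < s + m"
  defines "e \<equiv> entry m c"
  shows "e s r = e s (s+1) * inverse (e (r+1) (s+1)) * e (r+1) r
                 + e s (r+1) * inverse (e (s+1) (r+1)) * e (s+1) r"
    and "e r s = e r (r+1) * inverse (e (s+1) (r+1)) * e (s+1) s
                 + e r (s+1) * inverse (e (r+1) (s+1)) * e (r+1) s"
proof -
  have m: "r mod m < m" "s mod m < m" using nc_frieze.m_ge_3[OF assms(1)] by simp_all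
  have "distinct [r mod m, (r mod m + 1) mod m, s mod m, (s mod m + 1) mod m]"
    using mod_neq_of_less_window[of s "s+1" m] mod_neq_of_less_window[of s r m]
      mod_neq_of_less_window[of s "r+1" m] mod_neq_of_less_window[of "s+1" r m]
      mod_neq_of_less_window[of "s+1" "r+1" m] mod_neq_of_less_window[of r "r+1" m] assms(2,3)
    by (simp add: mod_Suc_eq)
  note relations = nc_frieze.exchange_relations[OF assms(1) m this, unfolded entry_mod, folded e_def]
  show "e s r = e s (s+1) * inverse (e (r+1) (s+1)) * e (r+1) r
                 + e s (r+1) * inverse (e (s+1) (r+1)) * e (s+1) r"
    using relations by (rule conjunct1)
  show "e r s = e r (r+1) * inverse (e (s+1) (r+1)) * e (s+1) s
                 + e r (s+1) * inverse (e (r+1) (s+1)) * e (r+1) s"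
    using relations by (elim conjE)
qed

theorem theorem4p1:
  fixes nrm :: "'a::division_ring \<Rightarrow> real"
    and R :: "'a set"
    and n :: nat
    and c :: "nat \<Rightarrow> nat \<Rightarrow> 'a"
    and M P :: real
  assumes "normed_division_ring nrm"
    and "R \<subseteq> UNIV - {0}"
    and "M = Inf {nrm x | x. x \<in> R}"
    and "M > 0"
    and "n \<ge> 1"
    and "nc_frieze_over R (n + 3) c"
    and "P = Max ((\<lambda>i. nrm (entry (n + 3) c i (i + 1))) ` {0..n + 2}
                  \<union> (\<lambda>i. nrm (entry (n + 3) c (i + 1) i)) ` {0..n + 2})"
  shows "\<forall>j < n + 3.
           nrm (entry (n + 3) c j (j + 2)) \<le> P\<^sup>2 * (M + real n * P) / M\<^sup>2 \<and>
           nrm (entry (n + 3) c (j + 2) j) \<le> P\<^sup>2 * (M + real n * P) / M\<^sup>2"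
proof -
  interpret normed_division_ring nrm by fact
  define m where "m = n + 3"
  define f where "f r s = nrm (entry m c r s)" for r s
  have frieze: "nc_frieze m c" and in_R: "\<And>r s. \<lbrakk>r < m; s < m; r \<noteq> s\<rbrakk> \<Longrightarrow> c r s \<in> R"
    using \<open>nc_frieze_over R (n + 3) c\<close> by (auto simp: nc_frieze_over_def m_def)
  have M_le: "M \<le> nrm x" if "x \<in> R" for x
    unfolding \<open>M = _\<close> using that nrm_nonneg by (intro cInf_lower) (auto intro!: bdd_belowI)
  have lower: "M \<le> f r s \<and> M \<le> f s r" if "r < s" "s < r + m" for r s
    using mod_neq_of_less_window[OF that] that
    by (auto simp: f_def entry_def m_def intro!: M_le in_R[unfolded m_def])
  have boundary: "f k (k+1) \<le> P \<and> f (k+1) k \<le> P" for k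
  proof -
    have i: "k mod m \<in> {0..n+2}" using mod_less_divisor[of m k] m_def by (simp del: mod_less_divisor)
    have "f (k mod m) (k mod m + 1) \<le> P" "f (k mod m + 1) (k mod m) \<le> P"
      unfolding \<open>P = _\<close> f_def m_def[symmetric] using i by (intro Max_ge; blast)+
    then show ?thesis by (simp only: f_def entry_mod)
  qed
  have exchange: "f s r \<le> f s (s+1) * f (r+1) r / f (r+1) (s+1)
                          + f s (r+1) * f (s+1) r / f (s+1) (r+1)"
    "f r s \<le> f (s+1) s * f r (r+1) / f (s+1) (r+1)
             + f (r+1) s * f r (s+1) / f (r+1) (s+1)"
    if "s + 2 \<le> r" "r \<le> s + n + 1" for r s
  proof -
    have r: "r + 1 < s + m" using that by (simp add: m_def)
    show "f s r \<le> f s (s+1) * f (r+1) r / f (r+1) (s+1)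
                  + f s (r+1) * f (s+1) r / f (s+1) (r+1)"
      unfolding f_def by (subst exchange_relations_cyclic(1)[OF frieze that(1) r]) (rule nrm_exchange_le)
    show "f r s \<le> f (s+1) s * f r (r+1) / f (s+1) (r+1)
                  + f (r+1) s * f r (s+1) / f (r+1) (s+1)"
      unfolding f_def
      by (subst exchange_relations_cyclic(2)[OF frieze that(1) r], rule order_trans[OF nrm_exchange_le])
        (simp add: mult.commute)
  qed
  \<comment> \<open>Replacing \<open>j\<close> by \<open>j + m\<close> exhibits the last numerator as a boundary entry.\<close>
  have wrap: "f j (j + n + 2) = f (j + n + 2 + 1) (j + n + 2)"
    "f (j + n + 2) j = f (j + n + 2) (j + n + 2 + 1)" for j
  proof -
    have "j + n + 2 + 1 = j + m" by (simp add: m_def)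
    then show "f j (j + n + 2) = f (j + n + 2 + 1) (j + n + 2)"
      "f (j + n + 2) j = f (j + n + 2) (j + n + 2 + 1)"
      unfolding f_def entry_def by (simp_all only: mod_add_self2)
  qed
  have nonneg: "0 \<le> f r s" for r s by (simp add: f_def nrm_nonneg)
  have lower': "M \<le> f (j+1) k \<and> M \<le> f k (j+1)" if "j + 2 \<le> k" "k \<le> j + n + 2" for j k
    using lower[of "j+1" k] that by (simp add: m_def)
  have last: "f j (j + n + 2) \<le> P \<and> f (j + n + 2) j \<le> P" for j
    unfolding wrap[of j] using boundary[of "j + n + 2"] by simp
  have "f j (j+2) \<le> P\<^sup>2 * (M + real n * P) / M\<^sup>2" for j
    by (rule quiddity_bound_of_exchange_inequality[where f = f and j = j and n = n,
          OF \<open>M > 0\<close> nonneg])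
      (use exchange(1) lower' boundary last in blast)+
  \<comment> \<open>The second exchange inequality is the first one for the transpose of \<open>f\<close>.\<close>
  moreover have "f (j+2) j \<le> P\<^sup>2 * (M + real n * P) / M\<^sup>2" for j
    by (rule quiddity_bound_of_exchange_inequality[where f = "\<lambda>r s. f s r" and j = j and n = n,
          OF \<open>M > 0\<close> nonneg])
      (use exchange(2) lower' boundary last in blast)+
  ultimately show ?thesis by (simp add: f_def m_def)
qed

end
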